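(* Let $f_0$ be a probability density function on $\mathbb{R}$ with $f_0(x)=f_0(-x)$ for all $x$. Let $G_1,G_2:\mathbb{R}\to\mathbb{R}$ be functions satisfying $G_k(x)\ge 0$ and $G_k(x)+G_k(-x)=1$ for all $x\in\mathbb{R}$ ($k=1,2$), and suppose that $G_2$ is greater than $G_1$ on the right. Then the distribution functions $$F_k(x)=\int_{-\infty}^x 2f_0(u)\,G_k(u)\,du,\qquad k=1,2,$$ satisfy $F_1(x)\ge F_2(x)$ for all $x\in\mathbb{R}$.
   Context: For functions $G_1,G_2$ on $\mathbb{R}$ with $G_k\ge0$ and $G_k(x)+G_k(-x)=1$, $G_2$ is said to be greater than $G_1$ on the right if $G_2(x)\ge G_1(x)$ for all $x>0$ and strict inequality holds for some $x>0$. The functions $G_k$ are understood to be measurable. *)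

theory Defs
  imports "HOL-Analysis.Analysis"
begin

(* Measurability is Lebesgue measurability, which subsumes the Borel case;
   has_bochner_integral includes the measurability of f. *)
definition prob_density :: "(real \<Rightarrow> real) \<Rightarrow> bool" where
  "prob_density f \<longleftrightarrow> (\<forall>x. f x \<ge> 0) \<and> has_bochner_integral lebesgue f 1"

definition skewing_function :: "(real \<Rightarrow> real) \<Rightarrow> bool" where
  "skewing_function G \<longleftrightarrow>
     G \<in> borel_measurable lebesgue \<and> (\<forall>x. G x \<ge> 0) \<and> (\<forall>x. G x + G (- x) = 1)"

definition greater_on_right :: "(real \<Rightarrow> real) \<Rightarrow> (real \<Rightarrow> real) \<Rightarrow> bool" where
  "greater_on_right G2 G1 \<longleftrightarrow> (\<forall>x>0. G2 x \<ge> G1 x) \<and> (\<exists>x>0. G2 x > G1 x)"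

(* The integrand is integrable for a density f and a skewing function G, as 0 \<le> G \<le> 1,
   so the default value 0 of the Bochner integral plays no role. *)
definition skew_cdf :: "(real \<Rightarrow> real) \<Rightarrow> (real \<Rightarrow> real) \<Rightarrow> real \<Rightarrow> real" where
  "skew_cdf f G x = (LINT u:{..x}|lebesgue. 2 * f u * G u)"

end

theory Submission
  imports Defs
begin

text \<open>
  The difference of the two integrands, \<open>2 * f0 u * (G1 u - G2 u)\<close>, is an odd function of \<open>u\<close>:
  \<open>f0\<close> is even, and \<open>G1 - G2\<close> is odd because \<open>G u - 1 / 2\<close> is odd for each skewing function \<open>G\<close>.
  It is nonpositive on the right half-line, hence nonnegative on the left one. So
  \<open>F1 x - F2 x\<close>, which is its integral over \<open>{..x}\<close>, is nonnegative as long as \<open>x \<le> 0\<close>;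
  beyond \<open>0\<close> it is nonincreasing and tends to the integral over the whole line, which is \<open>0\<close> by
  oddness. Hence it never becomes negative (\<open>odd_left_tail_integral_nonneg\<close>).
\<close>

lemma lebesgue_integral_odd_eq_0:
  fixes d :: "real \<Rightarrow> real"
  assumes odd: "\<And>u. d (- u) = - d u"
  shows "(LINT u|lebesgue. d u) = 0"
proof -
  have "(LINT u|lebesgue. d u) = (LINT u|lebesgue. d (- u))"
    using lebesgue_integral_real_affine[of "-1" d 0] by simp
  then show ?thesis
    by (simp add: odd)
qed

text \<open>
  A left tail that stays within the nonpositive half-line has a nonnegative integrand. A longer one
  is best seen through its complement: the two tails add up to \<open>0\<close>, and on the right tail the
  integrand is nonpositive.
\<close>

lemma odd_left_tail_integral_nonneg:
  fixes d :: "real \<Rightarrow> real"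
  assumes int: "integrable lebesgue d"
    and odd: "\<And>u. d (- u) = - d u"
    and nonpos: "\<And>u. u > 0 \<Longrightarrow> d u \<le> 0"
  shows "(LINT u:{..x}|lebesgue. d u) \<ge> 0"
proof (cases "x \<le> 0")
  case True
  have "d u \<ge> 0" if "u \<le> x" for u
    using nonpos[of "- u"] odd[of u] odd[of 0] that True by (cases "u = 0") auto
  then show ?thesis
    unfolding set_lebesgue_integral_def
    by (intro integral_nonneg_AE AE_I2) (auto simp: indicator_def)
next
  case False
  have int_on: "set_integrable lebesgue A d" if "A \<in> sets lebesgue" for A
    unfolding set_integrable_def using that int by (rule integrable_mult_indicator)
  have "(LINT u:{..x}|lebesgue. d u) + (LINT u:{x<..}|lebesgue. d u)
      = (LINT u:{..x} \<union> {x<..}|lebesgue. d u)"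
    by (intro set_integral_Un[symmetric] int_on) auto
  also have "{..x} \<union> {x<..} = UNIV"
    by auto
  also have "(LINT u:UNIV|lebesgue. d u) = 0"
    using lebesgue_integral_odd_eq_0[of d, OF odd] by (simp add: set_lebesgue_integral_def)
  finally have "(LINT u:{..x}|lebesgue. d u) = (LINT u:{x<..}|lebesgue. - d u)"
    by (simp add: set_integral_uminus int_on)
  also have "\<dots> \<ge> 0"
    unfolding set_lebesgue_integral_def using False nonpos
    by (intro integral_nonneg_AE AE_I2) (auto simp: indicator_def)
  finally show ?thesis .
qed

text \<open>
  The summands of \<open>G u + G (- u) = 1\<close> are nonnegative, so \<open>G\<close> is bounded by \<open>1\<close> and the
  product is dominated by \<open>2 * f\<close>.
\<close>

lemma integrable_skew_density:
  assumes f: "prob_density f" and G: "skewing_function G"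
  shows "integrable lebesgue (\<lambda>u. 2 * f u * G u)"
proof (rule Bochner_Integration.integrable_bound)
  have f_int: "integrable lebesgue f"
    using f by (auto simp: prob_density_def has_bochner_integral_iff)
  then show "integrable lebesgue (\<lambda>u. 2 * f u)"
    by simp
  show "(\<lambda>u. 2 * f u * G u) \<in> borel_measurable lebesgue"
    using f_int G by (auto simp: skewing_function_def)
  have "0 \<le> G u \<and> G u \<le> 1" for u
    using G unfolding skewing_function_def by (metis le_add_same_cancel1)
  then show "AE u in lebesgue. norm (2 * f u * G u) \<le> norm (2 * f u)"
    by (intro AE_I2) (simp add: abs_mult mult_left_le)
qed

theorem proposition6:
  fixes f0 G1 G2 :: "real \<Rightarrow> real"
  assumes "prob_density f0"
    and "\<forall>x. f0 x = f0 (- x)"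
    and "skewing_function G1"
    and "skewing_function G2"
    and "greater_on_right G2 G1"
  shows "\<forall>x. skew_cdf f0 G1 x \<ge> skew_cdf f0 G2 x"
proof
  fix x
  define d where "d u = 2 * f0 u * G1 u - 2 * f0 u * G2 u" for u
  have int: "integrable lebesgue (\<lambda>u. 2 * f0 u * G1 u)" "integrable lebesgue (\<lambda>u. 2 * f0 u * G2 u)"
    using assms integrable_skew_density by auto
  have "d (- u) = - d u" for u
  proof -
    have G: "G1 (- u) = 1 - G1 u" "G2 (- u) = 1 - G2 u"
      using assms unfolding skewing_function_def by (metis add_diff_cancel_left')+
    have f0: "f0 (- u) = f0 u"
      using assms(2) by metis
    show ?thesis
      unfolding d_def G f0 by algebra
  qed
  moreover have "d u \<le> 0" if "u > 0" for u
    using assms that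
    by (auto simp: d_def prob_density_def greater_on_right_def intro!: mult_left_mono)
  moreover have "integrable lebesgue d"
    unfolding d_def using int by (rule Bochner_Integration.integrable_diff)
  ultimately have "0 \<le> (LINT u:{..x}|lebesgue. d u)"
    by (intro odd_left_tail_integral_nonneg)
  also have "\<dots> = skew_cdf f0 G1 x - skew_cdf f0 G2 x"
    unfolding d_def skew_cdf_def
    by (intro set_integral_diff; unfold set_integrable_def; intro integrable_mult_indicator int)
      simp_all
  finally show "skew_cdf f0 G1 x \<ge> skew_cdf f0 G2 x"
    by simp
qed

end
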